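(* Let $X$ be a set and let $(R_H,R_S)$ be a non-trivial, semi-transitive and connected bi-relation on $X$. Then its soft part $R_S$ is complete and transitive.
   Context: A (binary) relation $R$ on a set $X$ is a subset of $X\times X$. Notation: $R^{-1}=\{(x,y) : (y,x)\in R\}$; upper and lower sections $R(x)=\{y : (x,y)\in R\}$ and $R^{-1}(x)=\{y : (y,x)\in R\}$; symmetric part $I=R\cap R^{-1}$; asymmetric part $P=R\setminus R^{-1}$. For relations $R,R'$ on $X$, the composition $R\circ R'$ is defined by: $(y,x)\in R\circ R'$ iff $R^{-1}(x)\cap R'(y)\neq\emptyset$ (i.e. there is $z$ with $(y,z)\in R'$ and $(z,x)\in R$). A relation $R$ is semi-transitive if $I\circ P\subseteq P$ and $P\circ I\subseteq P$; transitive if $R\circ R\subseteq R$; complete if $R\cup R^{-1}=X\times X$. A bi-relation on $X$ is a pair $(R_H,R_S)$ of relations on $X$ such that $R_H\subseteq R_S$ and $P_S\subseteq P_H$, where $I_H,P_H$ (resp. $I_S,P_S$) denote the symmetric and asymmetric parts of $R_H$ (resp. $R_S$). $R_H$ is called the hard part and $R_S$ the soft part. The bi-relation is non-trivial if $P_S\neq\emptyset$. It is semi-transitive if (i) $R_H$ is semi-transitive; (ii) $I_S\circ R_H\subseteq R_S$ and $R_H\circ I_S\subseteq R_S$; (iii) $P_H\cap(P_S\circ I_S)\subseteq P_S$ and $P_H\cap(I_S\circ P_S)\subseteq P_S$. The bi-relation $(R_H,R_S)$ is $p$-continuous if for all $x,y\in X$ there exist a topological space $\Lambda_{xy}$ and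 a function $f_{xy}:\Lambda_{xy}\to X$ with $x,y\in f_{xy}(\Lambda_{xy})$ such that for all $z\in X$ the sets $f_{xy}^{-1}(R_H(z))$ and $f_{xy}^{-1}(R_H^{-1}(z))$ are closed in $\Lambda_{xy}$ and the sets $f_{xy}^{-1}(P_S(z))$ and $f_{xy}^{-1}(P_S^{-1}(z))$ are open in $\Lambda_{xy}$. It is connected if it is $p$-continuous with each of the spaces $\Lambda_{xy}$ in this definition being connected. No topology or other structure on $X$ is assumed. *)

theory Defs
  imports "HOL-Analysis.Abstract_Topology"
begin

definition sym_part :: "'a rel \<Rightarrow> 'a rel" where
  "sym_part R = R \<inter> R\<inverse>"

definition asym_part :: "'a rel \<Rightarrow> 'a rel" where
  "asym_part R = R - R\<inverse>"

text \<open>Composition in functional order, the reverse of the library's \<^term>\<open>(O)\<close>: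
  a pair \<open>(y, x)\<close> belongs to \<open>R \<odot> R'\<close> iff \<open>(y, z) \<in> R'\<close> and \<open>(z, x) \<in> R\<close> for some \<open>z\<close>.\<close>

definition rel_compose :: "'a rel \<Rightarrow> 'a rel \<Rightarrow> 'a rel"  (infixr "\<odot>" 75) where
  "R \<odot> R' = R' O R"

definition semi_transitive :: "'a rel \<Rightarrow> bool" where
  "semi_transitive R \<longleftrightarrow>
     sym_part R \<odot> asym_part R \<subseteq> asym_part R \<and>
     asym_part R \<odot> sym_part R \<subseteq> asym_part R"

text \<open>Stronger than \<^const>\<open>total_on\<close>: completeness includes reflexivity.\<close>

definition complete_rel_on :: "'a set \<Rightarrow> 'a rel \<Rightarrow> bool" where
  "complete_rel_on X R \<longleftrightarrow> R \<union> R\<inverse> = X \<times> X"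

definition bi_relation :: "'a set \<Rightarrow> 'a rel \<Rightarrow> 'a rel \<Rightarrow> bool" where
  "bi_relation X R\<^sub>H R\<^sub>S \<longleftrightarrow>
     R\<^sub>H \<subseteq> X \<times> X \<and> R\<^sub>S \<subseteq> X \<times> X \<and>
     R\<^sub>H \<subseteq> R\<^sub>S \<and> asym_part R\<^sub>S \<subseteq> asym_part R\<^sub>H"

definition nontrivial_birel :: "'a rel \<Rightarrow> 'a rel \<Rightarrow> bool" where
  "nontrivial_birel R\<^sub>H R\<^sub>S \<longleftrightarrow> asym_part R\<^sub>S \<noteq> {}"

definition semi_transitive_birel :: "'a rel \<Rightarrow> 'a rel \<Rightarrow> bool" where
  "semi_transitive_birel R\<^sub>H R\<^sub>S \<longleftrightarrow>
     semi_transitive R\<^sub>H \<and>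
     sym_part R\<^sub>S \<odot> R\<^sub>H \<subseteq> R\<^sub>S \<and>
     R\<^sub>H \<odot> sym_part R\<^sub>S \<subseteq> R\<^sub>S \<and>
     asym_part R\<^sub>H \<inter> (asym_part R\<^sub>S \<odot> sym_part R\<^sub>S) \<subseteq> asym_part R\<^sub>S \<and>
     asym_part R\<^sub>H \<inter> (sym_part R\<^sub>S \<odot> asym_part R\<^sub>S) \<subseteq> asym_part R\<^sub>S"

text \<open>The conditions on a single space \<open>\<Lambda>\<close> and map \<open>f\<close> linking \<open>x\<close> and \<open>y\<close>. The upper section
  \<open>R(z)\<close> is \<open>R `` {z}\<close>, the lower section is \<open>R\<inverse> `` {z}\<close>.\<close>

definition p_continuous_via ::
  "'a set \<Rightarrow> 'a rel \<Rightarrow> 'a rel \<Rightarrow> 'b topology \<Rightarrow> ('b \<Rightarrow> 'a) \<Rightarrow> 'a \<Rightarrow> 'a \<Rightarrow> bool" where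
  "p_continuous_via X R\<^sub>H R\<^sub>S \<Lambda> f x y \<longleftrightarrow>
     f ` topspace \<Lambda> \<subseteq> X \<and> x \<in> f ` topspace \<Lambda> \<and> y \<in> f ` topspace \<Lambda> \<and>
     (\<forall>z\<in>X.
        closedin \<Lambda> {t \<in> topspace \<Lambda>. f t \<in> R\<^sub>H `` {z}} \<and>
        closedin \<Lambda> {t \<in> topspace \<Lambda>. f t \<in> R\<^sub>H\<inverse> `` {z}} \<and>
        openin \<Lambda> {t \<in> topspace \<Lambda>. f t \<in> asym_part R\<^sub>S `` {z}} \<and>
        openin \<Lambda> {t \<in> topspace \<Lambda>. f t \<in> (asym_part R\<^sub>S)\<inverse> `` {z}})"

text \<open>The type argument carries the points of the spaces \<open>\<Lambda>\<^sub>x\<^sub>y\<close>, since HOL cannot quantify over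
  types inside a formula. The carriers are arbitrary subsets of that type, varying with
  \<open>x\<close> and \<open>y\<close>; results should leave the type arbitrary.\<close>

definition p_continuous_birel ::
  "'b itself \<Rightarrow> 'a set \<Rightarrow> 'a rel \<Rightarrow> 'a rel \<Rightarrow> bool" where
  "p_continuous_birel _ X R\<^sub>H R\<^sub>S \<longleftrightarrow>
     (\<forall>x\<in>X. \<forall>y\<in>X. \<exists>(\<Lambda> :: 'b topology) f. p_continuous_via X R\<^sub>H R\<^sub>S \<Lambda> f x y)"

definition connected_birel ::
  "'b itself \<Rightarrow> 'a set \<Rightarrow> 'a rel \<Rightarrow> 'a rel \<Rightarrow> bool" where
  "connected_birel _ X R\<^sub>H R\<^sub>S \<longleftrightarrow>
     (\<forall>x\<in>X. \<forall>y\<in>X. \<exists>(\<Lambda> :: 'b topology) f.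
        p_continuous_via X R\<^sub>H R\<^sub>S \<Lambda> f x y \<and> connected_space \<Lambda>)"

end

theory Submission imports Defs begin

text \<open>If \<open>(x, y) \<in> P\<^sub>S\<close>, then semi-transitivity gives that
  \<open>P\<^sub>S(x) \<union> P\<^sub>S\<inverse>(y) = R\<^sub>H(x) \<union> R\<^sub>H\<inverse>(y)\<close>. This set has clopen preimages, so by connectedness it is
  all of \<open>X\<close>: thus \<open>P\<^sub>S\<close> is negatively transitive. If \<open>z\<close> and \<open>w\<close> were not \<open>R\<^sub>S\<close>-comparable,
  then any \<open>x\<close> strictly below (or above) \<open>z\<close> is strictly below (above) \<open>w\<close>, and the set
  \<open>P\<^sub>S\<inverse>(z) \<inter> P\<^sub>S\<inverse>(w) = R\<^sub>H\<inverse>(z) \<inter> R\<^sub>H\<inverse>(w)\<close> (or its dual) is clopen and nonempty, so contains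
  \<open>z\<close>, contradicting asymmetry. Hence \<open>R\<^sub>S\<close> is complete, and it is the complement of the
  converse of the negatively transitive \<open>P\<^sub>S\<close>, so it is transitive.\<close>

lemma asym_part_converse: "asym_part (R\<inverse>) = (asym_part R)\<inverse>"
  by (auto simp: asym_part_def)

lemma sym_part_converse: "sym_part (R\<inverse>) = sym_part R"
  by (auto simp: sym_part_def)

text \<open>The hypotheses come in mirror pairs and survive reversing both relations, so an argument
  about lower sections also yields its dual about upper sections.\<close>

lemma bi_relation_converse:
  assumes "bi_relation X H S"
  shows "bi_relation X (H\<inverse>) (S\<inverse>)"
  using assms unfolding bi_relation_def asym_part_converse by auto

lemma semi_transitive_birel_converse:
  assumes "semi_transitive_birel H S"
  shows "semi_transitive_birel (H\<inverse>) (S\<inverse>)"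
proof -
  have [simp]: "(sym_part R)\<inverse> = sym_part R" for R :: "'a rel"
    by (auto simp: sym_part_def)
  \<comment> \<open>A symmetric part shows no converse after rewriting, so compositions with one
    need their own forms of the rule.\<close>
  have compose: "A\<inverse> \<odot> B\<inverse> = (B \<odot> A)\<inverse>" "A\<inverse> \<odot> sym_part B = (sym_part B \<odot> A)\<inverse>"
    "sym_part B \<odot> A\<inverse> = (A \<odot> sym_part B)\<inverse>" for A B :: "'a rel"
    by (auto simp: rel_compose_def sym_part_def)
  show ?thesis
    using assms
    unfolding semi_transitive_birel_def semi_transitive_def asym_part_converse sym_part_converse
    by (simp add: compose flip: converse_Int)
qed

lemma connected_birel_converse:
  assumes "connected_birel TYPE('b) X H S"
  shows "connected_birel TYPE('b) X (H\<inverse>) (S\<inverse>)"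
  using assms
  unfolding connected_birel_def p_continuous_via_def asym_part_converse converse_converse
  by (simp only: conj_ac)

text \<open>The preimage of \<open>A\<close> is clopen and contains a point mapped to
  \<open>x\<close>, so it is the whole connected space, including a point mapped to
  \<open>y\<close>.\<close>

lemma connected_birel_clopen:
  assumes conn: "connected_birel TYPE('b) X H S" and "x \<in> X" "y \<in> X" "x \<in> A"
    and clopen: "\<And>(\<Lambda> :: 'b topology) f. p_continuous_via X H S \<Lambda> f x y \<Longrightarrow>
      openin \<Lambda> {t \<in> topspace \<Lambda>. f t \<in> A} \<and> closedin \<Lambda> {t \<in> topspace \<Lambda>. f t \<in> A}"
  shows "y \<in> A"
proof -
  obtain \<Lambda> :: "'b topology" and f where
    via: "p_continuous_via X H S \<Lambda> f x y" and "connected_space \<Lambda>"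
    using assms unfolding connected_birel_def by meson
  then have "{t \<in> topspace \<Lambda>. f t \<in> A} = {} \<or> {t \<in> topspace \<Lambda>. f t \<in> A} = topspace \<Lambda>"
    using clopen[OF via] unfolding connected_space_clopen_in by blast
  moreover have "x \<in> f ` topspace \<Lambda>" "y \<in> f ` topspace \<Lambda>"
    using via by (auto simp: p_continuous_via_def)
  ultimately show ?thesis
    using \<open>x \<in> A\<close> by blast
qed

text \<open>If both alternatives fail, \<open>w\<close> is soft-indifferent to \<open>x\<close> and
  then to \<open>y\<close>. If \<open>(w, x)\<close> is hard, composing it with the indifference of
  \<open>y\<close> and \<open>w\<close> gives \<open>(y, x) \<in> S\<close>; otherwise
  \<open>(x, w)\<close> is hard-strict and condition (iii) makes it soft-strict.\<close>

lemma asym_part_soft_step: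
  assumes bi: "bi_relation X H S" and semi: "semi_transitive_birel H S"
    and xy: "(x, y) \<in> asym_part S" and xw: "(x, w) \<in> H"
  shows "(x, w) \<in> asym_part S \<or> (w, y) \<in> asym_part S"
proof (rule ccontr)
  assume neg: "\<not> ?thesis"
  have "H \<subseteq> S" and P: "asym_part S \<subseteq> asym_part H"
    using bi by (auto simp: bi_relation_def)
  have IH: "(a, c) \<in> S" if "(a, b) \<in> sym_part S" "(b, c) \<in> H" for a b c
    using semi that unfolding semi_transitive_birel_def rel_compose_def by blast
  have HI: "(a, c) \<in> S" if "(a, b) \<in> H" "(b, c) \<in> sym_part S" for a b c
    using semi that unfolding semi_transitive_birel_def rel_compose_def by blast
  have xHy: "(x, y) \<in> H"
    using P xy by (auto simp: asym_part_def)
  have xIw: "(w, x) \<in> sym_part S"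
    using neg xw \<open>H \<subseteq> S\<close> by (auto simp: asym_part_def sym_part_def)
  have yIw: "(y, w) \<in> sym_part S"
    using IH[OF xIw xHy] neg by (auto simp: asym_part_def sym_part_def)
  show False
  proof (cases "(w, x) \<in> H")
    case True
    then show False
      using IH[OF yIw] xy by (auto simp: asym_part_def)
  next
    case False
    then have "(x, w) \<in> asym_part H"
      using xw by (auto simp: asym_part_def)
    then have "(x, w) \<in> asym_part S"
      using semi xy yIw unfolding semi_transitive_birel_def rel_compose_def by blast
    then show False
      using neg by blast
  qed
qed

lemma asym_part_soft_negatively_transitive:
  assumes bi: "bi_relation X H S" and semi: "semi_transitive_birel H S"
    and conn: "connected_birel TYPE('b) X H S"
    and xy: "(x, y) \<in> asym_part S" and "z \<in> X"
  shows "(x, z) \<in> asym_part S \<or> (z, y) \<in> asym_part S"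
proof -
  let ?A = "asym_part S `` {x} \<union> (asym_part S)\<inverse> `` {y}"
  have X: "x \<in> X" "y \<in> X"
    using bi xy by (auto simp: bi_relation_def asym_part_def)
  have P: "asym_part S \<subseteq> H"
    using bi by (auto simp: bi_relation_def asym_part_def)
  have lower: "(x, w) \<in> asym_part S \<or> (w, y) \<in> asym_part S" if "(w, y) \<in> H" for w
    using asym_part_soft_step[OF bi_relation_converse[OF bi] semi_transitive_birel_converse[OF semi],
        of y x w] xy that
    by (auto simp: asym_part_converse)
  have A: "?A = H `` {x} \<union> H\<inverse> `` {y}"
    using P lower asym_part_soft_step[OF bi semi xy] by blast
  have "z \<in> ?A"
  proof (rule connected_birel_clopen[OF conn \<open>y \<in> X\<close> \<open>z \<in> X\<close>])
    fix \<Lambda> :: "'b topology" and f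
    assume "p_continuous_via X H S \<Lambda> f y z"
    then have
      "openin \<Lambda> ({t \<in> topspace \<Lambda>. f t \<in> asym_part S `` {x}} \<union>
        {t \<in> topspace \<Lambda>. f t \<in> (asym_part S)\<inverse> `` {y}})"
      "closedin \<Lambda> ({t \<in> topspace \<Lambda>. f t \<in> H `` {x}} \<union> {t \<in> topspace \<Lambda>. f t \<in> H\<inverse> `` {y}})"
      using X unfolding p_continuous_via_def by blast+
    moreover have
      "{t \<in> topspace \<Lambda>. f t \<in> B \<union> C} = {t \<in> topspace \<Lambda>. f t \<in> B} \<union> {t \<in> topspace \<Lambda>. f t \<in> C}"
      for B C by blast
    ultimately show "openin \<Lambda> {t \<in> topspace \<Lambda>. f t \<in> ?A} \<and> closedin \<Lambda> {t \<in> topspace \<Lambda>. f t \<in> ?A}"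
      using A by metis
  qed (use xy in auto)
  then show ?thesis
    by auto
qed

lemma comparable_if_common_strict_lower:
  assumes bi: "bi_relation X H S" and semi: "semi_transitive_birel H S"
    and conn: "connected_birel TYPE('b) X H S"
    and xz: "(x, z) \<in> asym_part S" and xw: "(x, w) \<in> asym_part S"
  shows "(z, w) \<in> S \<or> (w, z) \<in> S"
proof (rule ccontr)
  assume neg: "\<not> ?thesis"
  let ?A = "(asym_part S)\<inverse> `` {z} \<inter> (asym_part S)\<inverse> `` {w}"
  have X: "x \<in> X" "z \<in> X" "w \<in> X"
    using bi xz xw by (auto simp: bi_relation_def asym_part_def)
  have P: "asym_part S \<subseteq> H" and "H \<subseteq> S"
    using bi by (auto simp: bi_relation_def asym_part_def)
  have IH: "(a, c) \<in> S" if "(a, b) \<in> sym_part S" "(b, c) \<in> H" for a b c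
    using semi that unfolding semi_transitive_birel_def rel_compose_def by blast
  \<comment> \<open>Were \<open>u\<close> soft-indifferent to one of \<open>z\<close>,
    \<open>w\<close>, composing with the hard relation to the other would make \<open>z\<close> and
    \<open>w\<close> comparable.\<close>
  have "(u, z) \<in> asym_part S \<and> (u, w) \<in> asym_part S" if "(u, z) \<in> H" "(u, w) \<in> H" for u
    using that neg \<open>H \<subseteq> S\<close> IH[of z u w] IH[of w u z] by (auto simp: asym_part_def sym_part_def)
  then have A: "?A = H\<inverse> `` {z} \<inter> H\<inverse> `` {w}"
    using P by blast
  have "z \<in> ?A"
  proof (rule connected_birel_clopen[OF conn \<open>x \<in> X\<close> \<open>z \<in> X\<close>])
    fix \<Lambda> :: "'b topology" and f
    assume "p_continuous_via X H S \<Lambda> f x z"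
    then have
      "openin \<Lambda> ({t \<in> topspace \<Lambda>. f t \<in> (asym_part S)\<inverse> `` {z}} \<inter>
        {t \<in> topspace \<Lambda>. f t \<in> (asym_part S)\<inverse> `` {w}})"
      "closedin \<Lambda> ({t \<in> topspace \<Lambda>. f t \<in> H\<inverse> `` {z}} \<inter> {t \<in> topspace \<Lambda>. f t \<in> H\<inverse> `` {w}})"
      using X unfolding p_continuous_via_def by blast+
    moreover have
      "{t \<in> topspace \<Lambda>. f t \<in> B \<inter> C} = {t \<in> topspace \<Lambda>. f t \<in> B} \<inter> {t \<in> topspace \<Lambda>. f t \<in> C}"
      for B C by blast
    ultimately show "openin \<Lambda> {t \<in> topspace \<Lambda>. f t \<in> ?A} \<and> closedin \<Lambda> {t \<in> topspace \<Lambda>. f t \<in> ?A}"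
      using A by metis
  qed (use xz xw in auto)
  then show False
    by (auto simp: asym_part_def)
qed

theorem theorem1:
  fixes X :: "'a set" and R\<^sub>H R\<^sub>S :: "'a rel"
  assumes "bi_relation X R\<^sub>H R\<^sub>S"
    and "nontrivial_birel R\<^sub>H R\<^sub>S"
    and "semi_transitive_birel R\<^sub>H R\<^sub>S"
    and "connected_birel TYPE('b) X R\<^sub>H R\<^sub>S"
  shows "complete_rel_on X R\<^sub>S \<and> trans R\<^sub>S"
proof -
  let ?P = "asym_part R\<^sub>S"
  have sub: "R\<^sub>S \<subseteq> X \<times> X"
    using assms(1) by (simp add: bi_relation_def)
  have negtrans: "(x, z) \<in> ?P \<or> (z, y) \<in> ?P" if "(x, y) \<in> ?P" "z \<in> X" for x y z
    using asym_part_soft_negatively_transitive[OF assms(1,3,4) that] .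
  obtain x y where xy: "(x, y) \<in> ?P"
    using assms(2) by (auto simp: nontrivial_birel_def)
  have total: "(z, w) \<in> R\<^sub>S \<or> (w, z) \<in> R\<^sub>S" if X: "z \<in> X" "w \<in> X" for z w
  proof (rule ccontr)
    assume neg: "\<not> ?thesis"
    then have nP: "(z, w) \<notin> ?P" "(w, z) \<notin> ?P"
      by (auto simp: asym_part_def)
    \<comment> \<open>Inserting \<open>z\<close> into the strict pair gives a strict bound for
      \<open>z\<close> on one side; inserting \<open>w\<close> next makes it a bound for
      \<open>w\<close> as well.\<close>
    consider "(x, z) \<in> ?P" | "(z, y) \<in> ?P"
      using negtrans[OF xy \<open>z \<in> X\<close>] by blast
    then show False
    proof cases
      case 1
      then have "(x, w) \<in> ?P"
        using negtrans X nP by blast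
      then show False
        using comparable_if_common_strict_lower[OF assms(1,3,4) 1] neg by blast
    next
      case 2
      then have "(w, y) \<in> ?P"
        using negtrans X nP by blast
      then show False
        using comparable_if_common_strict_lower[OF bi_relation_converse[OF assms(1)]
            semi_transitive_birel_converse[OF assms(3)] connected_birel_converse[OF assms(4)],
            of y z w] 2 neg
        by (auto simp: asym_part_converse)
    qed
  qed
  have "trans R\<^sub>S"
  proof (rule transI)
    fix a b c
    assume ab: "(a, b) \<in> R\<^sub>S" and bc: "(b, c) \<in> R\<^sub>S"
    then have X: "a \<in> X" "b \<in> X" "c \<in> X"
      using sub by auto
    \<comment> \<open>Inserting \<open>b\<close> into a strict pair \<open>(c, a)\<close> would
      reverse \<open>bc\<close> or \<open>ab\<close> strictly.\<close>
    have "(c, a) \<notin> ?P"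
      using negtrans[of c a b] X ab bc by (auto simp: asym_part_def)
    then show "(a, c) \<in> R\<^sub>S"
      using total[OF X(1,3)] by (auto simp: asym_part_def)
  qed
  then show ?thesis
    using total sub by (auto simp: complete_rel_on_def)
qed

end
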